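(* Let $n, d_1, d_2$ be positive integers with $d_1\le d_2$, and let $\mathbf X_1,\dots,\mathbf X_n\in\mathbb R^{d_1\times d_2}$ be arbitrary fixed matrices. For every $\varepsilon$ with $0<\varepsilon<1$ and every positive integer $r$, $$\mathcal N_\varepsilon(\mathcal P(r))\ \le\ 2^{r d_1}\left\{\frac{12\, r\, d_1\, n^3}{\varepsilon}\right\}^{r d_2+1}.$$
   Context: For $\mathbf V\in\mathbb R^{d_2\times r}$, let $\mathbf X_{\mathbf V}\in\mathbb R^{n\times r d_1}$ be the matrix whose $i$th row is the vectorization $\mathrm{vec}(\mathbf X_i\mathbf V)$ of $\mathbf X_i\mathbf V\in\mathbb R^{d_1\times r}$. Let $\mathbf P_{\mathbf V}\in\mathbb R^{n\times n}$ be the orthogonal projection matrix onto the column space of $\mathbf X_{\mathbf V}$ (so $\mathbf P_{\mathbf V}=\mathbf X_{\mathbf V}(\mathbf X_{\mathbf V}^\top\mathbf X_{\mathbf V})^{-1}\mathbf X_{\mathbf V}^\top$ when $\mathbf X_{\mathbf V}^\top\mathbf X_{\mathbf V}$ is invertible). Define $\mathcal P(r)=\{\mathbf P_{\mathbf V}:\mathbf V\in\mathbb R^{d_2\times r}\}$, regarded as a metric space with the Hilbert–Schmidt (Frobenius) norm distance. A set $\mathcal S\subseteq\mathcal P(r)$ is an $\varepsilon$-net of $\mathcal P(r)$ if for every $\mathbf P\in\mathcal P(r)$ there is $\tilde{\mathbf P}\in\mathcal S$ with $\|\mathbf P-\tilde{\mathbf P}\|_{\mathrm{HS}}\le\varepsilon$.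 The covering number $\mathcal N_\varepsilon(\mathcal P(r))$ is the minimum cardinality of an $\varepsilon$-net of $\mathcal P(r)$. *)

theory Defs
  imports "HOL-Analysis.Analysis"
begin

(* A d1 x d2 matrix has type real^'d2^'d1, with d1 = CARD('d1) and d2 = CARD('d2); finite index
   types are nonempty, so all dimensions are positive. *)

(* The coordinates of vec(M) are indexed by pairs (row, column) rather than by 1, ..., d1 * r.
   The enumeration of the pairs permutes the columns of X_V and does not affect its column space. *)
definition vec_mat :: "real^'r^'d1 \<Rightarrow> real^('d1 \<times> 'r)"
  where "vec_mat M = (\<chi> p. M $ fst p $ snd p)"

definition XV :: "('n \<Rightarrow> real^'d2^'d1) \<Rightarrow> real^'r^'d2 \<Rightarrow> real^('d1 \<times> 'r)^'n"
  where "XV X V = (\<chi> i. vec_mat (X i ** V))"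

definition is_orth_proj_matrix :: "(real^'n) set \<Rightarrow> real^'n^'n \<Rightarrow> bool"
  where "is_orth_proj_matrix S P \<longleftrightarrow> (\<forall>x. P *v x \<in> S \<and> x - P *v x \<in> S\<^sup>\<bottom>)"

(* Well defined whenever S is a subspace: see orth_proj_matrix_unique_exists. *)
definition orth_proj_matrix :: "(real^'n) set \<Rightarrow> real^'n^'n"
  where "orth_proj_matrix S = (THE P. is_orth_proj_matrix S P)"

definition PV :: "('n \<Rightarrow> real^'d2^'d1) \<Rightarrow> real^'r^'d2 \<Rightarrow> real^'n^'n"
  where "PV X V = orth_proj_matrix (span (columns (XV X V)))"

(* The first argument carries only r = CARD('r). *)
definition PP :: "'r::finite itself \<Rightarrow> ('n \<Rightarrow> real^'d2^'d1) \<Rightarrow> (real^'n^'n) set"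
  where "PP _ X = range (\<lambda>V :: real^'r^'d2. PV X V)"

definition eps_net :: "real \<Rightarrow> 'a::metric_space set \<Rightarrow> 'a set \<Rightarrow> bool"
  where "eps_net \<epsilon> A S \<longleftrightarrow> S \<subseteq> A \<and> (\<forall>P\<in>A. \<exists>Q\<in>S. dist P Q \<le> \<epsilon>)"

(* Infinity if there is no finite net. *)
definition covering_number :: "real \<Rightarrow> 'a::metric_space set \<Rightarrow> enat"
  where "covering_number \<epsilon> A = (INF S \<in> {S. finite S \<and> eps_net \<epsilon> A S}. enat (card S))"

(* The library metric on real^'n^'m is the Hilbert-Schmidt distance. *)
lemma dist_matrix_eq_HS:
  fixes A B :: "real^'n^'m"
  shows "dist A B = sqrt (\<Sum>i\<in>UNIV. \<Sum>j\<in>UNIV. (A $ i $ j - B $ i $ j)\<^sup>2)"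
  by (simp add: dist_norm norm_vec_def L2_set_def sum_nonneg)

lemma orth_proj_matrix_unique:
  fixes S :: "(real^'n) set"
  assumes S: "subspace S" and P: "is_orth_proj_matrix S P" and Q: "is_orth_proj_matrix S Q"
  shows "P = Q"
proof -
  have "P *v x = Q *v x" for x
  proof -
    have 1: "P *v x - Q *v x \<in> S"
      using P Q S by (simp add: is_orth_proj_matrix_def subspace_diff)
    have "(x - Q *v x) - (x - P *v x) \<in> S\<^sup>\<bottom>"
      by (rule subspace_diff[OF subspace_orthogonal_comp])
        (use P Q in \<open>simp_all add: is_orth_proj_matrix_def\<close>)
    hence "P *v x - Q *v x \<in> S\<^sup>\<bottom>" by simp
    with 1 have "orthogonal (P *v x - Q *v x) (P *v x - Q *v x)"
      by (auto simp: orthogonal_comp_def)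
    thus ?thesis by (simp add: orthogonal_self)
  qed
  thus ?thesis by (simp add: matrix_eq)
qed

lemma orth_proj_matrix_unique_exists:
  fixes S :: "(real^'n) set"
  assumes S: "subspace S"
  shows "\<exists>!P. is_orth_proj_matrix S P"
proof -
  have "\<forall>x. \<exists>y. y \<in> S \<and> x - y \<in> S\<^sup>\<bottom>"
  proof
    fix x :: "real^'n"
    obtain y z where "y \<in> span S" "\<And>w. w \<in> span S \<Longrightarrow> orthogonal z w" "x = y + z"
      using orthogonal_subspace_decomp_exists by blast
    thus "\<exists>y. y \<in> S \<and> x - y \<in> S\<^sup>\<bottom>"
      using S by (intro exI[of _ y]) (auto simp: orthogonal_comp_def orthogonal_commute span_eq_iff[THEN iffD2])
  qed
  then obtain f where f: "\<And>x. f x \<in> S" "\<And>x. x - f x \<in> S\<^sup>\<bottom>" by metis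
  have uniq: "y = f x" if "y \<in> S" "x - y \<in> S\<^sup>\<bottom>" for x y
  proof -
    have 1: "y - f x \<in> S" using S that f by (simp add: subspace_diff)
    have "(x - f x) - (x - y) \<in> S\<^sup>\<bottom>"
      by (rule subspace_diff[OF subspace_orthogonal_comp]) (use that f in auto)
    hence "y - f x \<in> S\<^sup>\<bottom>" by simp
    with 1 have "orthogonal (y - f x) (y - f x)" by (auto simp: orthogonal_comp_def)
    thus ?thesis by (simp add: orthogonal_self)
  qed
  have "linear f"
  proof (rule linearI)
    fix x y :: "real^'n"
    have "(x - f x) + (y - f y) \<in> S\<^sup>\<bottom>"
      by (rule subspace_add[OF subspace_orthogonal_comp]) (use f in auto)
    hence "(x + y) - (f x + f y) \<in> S\<^sup>\<bottom>" by (simp add: algebra_simps)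
    with S f show "f (x + y) = f x + f y" by (intro uniq[symmetric]) (simp_all add: subspace_add)
  next
    fix c :: real and x :: "real^'n"
    have "c *\<^sub>R (x - f x) \<in> S\<^sup>\<bottom>"
      by (rule subspace_scale[OF subspace_orthogonal_comp]) (use f in auto)
    hence "c *\<^sub>R x - c *\<^sub>R f x \<in> S\<^sup>\<bottom>" by (simp add: scaleR_diff_right)
    with S f show "f (c *\<^sub>R x) = c *\<^sub>R f x" by (intro uniq[symmetric]) (simp_all add: subspace_scale)
  qed
  hence "is_orth_proj_matrix S (matrix f)"
    using f by (simp add: is_orth_proj_matrix_def matrix_works)
  thus ?thesis using orth_proj_matrix_unique[OF S] by blast
qed

lemma is_orth_proj_matrix_orth_proj_matrix:
  assumes "subspace S"
  shows "is_orth_proj_matrix S (orth_proj_matrix S)"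
  unfolding orth_proj_matrix_def by (rule theI'[OF orth_proj_matrix_unique_exists[OF assms]])

lemma PV_eq_if_invertible:
  fixes X :: "'n::finite \<Rightarrow> real^'d2^'d1" and V :: "real^'r^'d2"
  assumes inv: "invertible (transpose (XV X V) ** XV X V)"
  shows "PV X V =
    XV X V ** matrix_inv (transpose (XV X V) ** XV X V) ** transpose (XV X V)"
proof -
  define A where "A = XV X V"
  define G where "G = matrix_inv (transpose A ** A)"
  have sub: "subspace (range ((*v) A))"
    by (intro linear_subspace_image matrix_vector_mul_linear subspace_UNIV)
  have sp: "span (columns A) = range ((*v) A)"
  proof
    have "columns A \<subseteq> range ((*v) A)"
      unfolding columns_image_basis by (rule image_mono) simp
    thus "span (columns A) \<subseteq> range ((*v) A)"
      using sub by (rule span_minimal)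
    show "range ((*v) A) \<subseteq> span (columns A)"
      using matrix_vector_mult_in_columnspace by (rule image_subsetI)
  qed
  have G: "(transpose A ** A) ** G = mat 1"
    using inv unfolding G_def A_def[symmetric] invertible_def matrix_inv_def
    by (rule someI2_ex) simp
  have "is_orth_proj_matrix (range ((*v) A)) (A ** G ** transpose A)"
    unfolding is_orth_proj_matrix_def
  proof (intro allI conjI)
    fix x
    have "(A ** G ** transpose A) *v x = A *v ((G ** transpose A) *v x)"
      by (simp only: matrix_vector_mul_assoc matrix_mul_assoc)
    thus "(A ** G ** transpose A) *v x \<in> range ((*v) A)"
      by simp
    have "transpose A ** (A ** G ** transpose A) = transpose A"
      using G by (simp add: matrix_mul_assoc)
    hence "transpose A *v ((A ** G ** transpose A) *v x) = transpose A *v x"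
      by (simp only: matrix_vector_mul_assoc)
    hence "transpose A *v (x - (A ** G ** transpose A) *v x) = 0"
      by (simp add: matrix_vector_mult_diff_distrib)
    hence "inner (A *v u) (x - (A ** G ** transpose A) *v x) = 0" for u
      using dot_lmul_matrix[of "x - (A ** G ** transpose A) *v x" A u]
      by (simp add: transpose_matrix_vector inner_commute)
    thus "x - (A ** G ** transpose A) *v x \<in> (range ((*v) A))\<^sup>\<bottom>"
      by (auto simp: orthogonal_comp_def orthogonal_def)
  qed
  moreover have "is_orth_proj_matrix (range ((*v) A)) (PV X V)"
    unfolding PV_def A_def[symmetric] sp
    using sub by (rule is_orth_proj_matrix_orth_proj_matrix)
  ultimately show ?thesis
    unfolding A_def[symmetric] G_def[symmetric]
    using orth_proj_matrix_unique[OF sub] by blast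
qed

end

theory Submission
  imports Defs
begin

text \<open>
  Every projection in the family is determined by the \<open>m = r * d2\<close> entries of \<open>V\<close>, and a set of
  projections with mutual distances above \<open>\<epsilon>\<close> is bounded in size by the number of monomials in
  \<open>m\<close> variables up to a certain degree. A maximal set of this kind is an \<open>\<epsilon>\<close>-net
  (\<open>covering_number_le_packing_bound\<close>), so the task is to bound separated sets.

  Given separated projections \<open>P\<close>, attach to each one the function \<open>Q \<mapsto> T ((dist P Q)\<^sup>2)\<close>, where \<open>T\<close>
  is a rescaled Chebyshev polynomial of degree \<open>k\<close>, of modulus at most 1 on the possible squared
  distances \<open>{\<epsilon>\<^sup>2..n\<^sup>2}\<close> and larger than \<open>exp (k * \<epsilon> / n) / 2\<close> at 0. If \<open>k\<close> is about \<open>n / \<epsilon>\<close> times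
  the logarithm of the number of projections, the matrix of values of these functions at the
  given projections is strictly diagonally dominant, hence the functions are linearly independent
  (\<open>card_le_if_diagonally_dominant\<close>).

  They also live in a small space. For fixed \<open>P\<close>, the squared distance is affine in the projection
  \<open>Q\<close> (\<open>dist_sq_orth_proj\<close>), and the projection onto a column space is the limit, as \<open>t\<close> decreases
  to 0, of matrices whose entries are quotients of polynomials of degree at most \<open>2 * r * d1\<close> in the
  entries of \<open>V\<close> with a common denominator (\<open>tikhonov_tendsto_orth_proj\<close>). Diagonal dominance is
  stable under a small perturbation, so after multiplication by the \<open>k\<close>-th power of the denominator
  one obtains linearly independent polynomials of degree at most \<open>2 * r * d1 * k\<close>. Their number is
  at most \<open>(exp 1 * (1 + 2 * r * d1 * k / m)) ^ m\<close> (\<open>card_exponents_le\<close>, combined in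
  \<open>card_separated_orth_proj_le\<close>).

  The logarithm in \<open>k\<close> is absorbed by the extra factor in the exponent \<open>m + 1\<close>, provided that \<open>m\<close> is
  at most \<open>n\<^sup>2\<close> (\<open>packing_exponent_arithmetic\<close>). For larger \<open>m\<close>, a grid in the space of all \<open>n\<close> by
  \<open>n\<close> matrices gives a better bound (\<open>card_separated_matrices_le\<close>). In both cases separated sets have
  at most \<open>(12 * r * d1 * n ^ 3 / \<epsilon>) ^ (m + 1)\<close> elements.
\<close>

section \<open>Polynomial functions of bounded degree\<close>

text \<open>
  The degree bound matters only through the number of monomials it allows, so a polynomial
  function is represented by an explicit linear combination of monomials, and the degree of a
  product is controlled by adding exponents.
\<close>

definition exponents :: "nat \<Rightarrow> ('i::finite \<Rightarrow> nat) set"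
  where "exponents d = {a. sum a UNIV \<le> d}"

definition monomial :: "('i::finite \<Rightarrow> nat) \<Rightarrow> ('i \<Rightarrow> real) \<Rightarrow> real"
  where "monomial a x = (\<Prod>i\<in>UNIV. x i ^ a i)"

definition poly_fun :: "nat \<Rightarrow> (('i::finite \<Rightarrow> real) \<Rightarrow> real) \<Rightarrow> bool"
  where "poly_fun d f \<longleftrightarrow> (\<exists>c. \<forall>x. f x = (\<Sum>a\<in>exponents d. c a * monomial a x))"

lemma mem_exponents: "a \<in> exponents d \<longleftrightarrow> sum a UNIV \<le> d"
  by (simp add: exponents_def)

lemma poly_funI: "(\<And>x. f x = (\<Sum>a\<in>exponents d. c a * monomial a x)) \<Longrightarrow> poly_fun d f"
  unfolding poly_fun_def by blast

lemma exponents_subset_box: "exponents d \<subseteq> (UNIV :: 'i::finite set) \<rightarrow>\<^sub>E {..d}"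
proof
  fix a :: "'i \<Rightarrow> nat" assume a: "a \<in> exponents d"
  have "a i \<le> d" for i
    using member_le_sum[of i UNIV a] a by (simp add: mem_exponents)
  then show "a \<in> UNIV \<rightarrow>\<^sub>E {..d}" by auto
qed

lemma finite_exponents [simp]: "finite (exponents d :: ('i::finite \<Rightarrow> nat) set)"
  by (rule finite_subset[OF exponents_subset_box]) (simp add: finite_PiE)

text \<open>
  A generating function argument: for \<open>0 < z < 1\<close>, each exponent vector of total degree at most
  \<open>d\<close> contributes at least \<open>z ^ d\<close> to the product of \<open>m\<close> geometric series in \<open>z\<close>, which is at
  most \<open>(1 / (1 - z)) ^ m\<close>. The choice \<open>z = d / (d + m)\<close> minimises \<open>z ^ (- d) * (1 - z) ^ (- m)\<close>.
\<close>

lemma card_exponents_le: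
  assumes "0 < d"
  shows "real (card (exponents d :: ('i::finite \<Rightarrow> nat) set))
    \<le> (exp 1 * (1 + real d / real CARD('i))) ^ CARD('i)"
proof -
  define m where "m = CARD('i)"
  define z where "z = real d / (real d + real m)"
  have m: "0 < m" by (simp add: m_def)
  have z: "0 < z" "z < 1" "1 / (1 - z) = 1 + real d / real m" "1 / z = 1 + real m / real d"
    using assms m by (auto simp: z_def field_simps)
  let ?E = "exponents d :: ('i \<Rightarrow> nat) set"
  have "real (card ?E) * z ^ d = (\<Sum>a\<in>?E. z ^ d)" by simp
  also have "\<dots> \<le> (\<Sum>a\<in>?E. \<Prod>i\<in>UNIV. z ^ a i)"
    using z by (intro sum_mono) (auto simp: mem_exponents power_sum[symmetric] intro!: power_decreasing)
  also have "\<dots> \<le> (\<Sum>a\<in>(UNIV :: 'i set) \<rightarrow>\<^sub>E {..d}. \<Prod>i\<in>UNIV. z ^ a i)"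
    using z by (intro sum_mono2 exponents_subset_box) (auto simp: finite_PiE intro!: prod_nonneg)
  also have "\<dots> = (\<Prod>i\<in>(UNIV :: 'i set). \<Sum>j\<le>d. z ^ j)"
    by (subst prod_sum_PiE) auto
  also have "\<dots> = (\<Sum>j\<le>d. z ^ j) ^ m" by (simp add: m_def)
  also have "\<dots> \<le> (1 / (1 - z)) ^ m"
  proof (intro power_mono sum_nonneg)
    show "(\<Sum>j\<le>d. z ^ j) \<le> 1 / (1 - z)"
      using z(1,2) by (simp add: sum_gp0 divide_right_mono)
  qed (use z in auto)
  finally have "real (card ?E) * z ^ d \<le> (1 + real d / real m) ^ m"
    using z by simp
  then have "real (card ?E) \<le> (1 / z) ^ d * (1 + real d / real m) ^ m"
    using z by (simp add: field_simps power_divide)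
  also have "(1 / z) ^ d \<le> exp (real m / real d) ^ d"
    using z by (intro power_mono) (simp_all add: exp_ge_add_one_self)
  also have "\<dots> = exp 1 ^ m"
    using assms by (simp add: exp_of_nat_mult[symmetric])
  finally show ?thesis
    by (simp add: m_def power_mult_distrib mult_right_mono)
qed

lemma poly_fun_const: "poly_fun d (\<lambda>x. c)"
proof -
  have "c = (\<Sum>a\<in>exponents d. (if a = (\<lambda>_. 0) then c else 0) * monomial a x)" for x
    by (subst sum.remove[of _ "\<lambda>_. 0"]) (auto simp: mem_exponents monomial_def)
  then show ?thesis by (rule poly_funI)
qed

lemma poly_fun_coord: "poly_fun 1 (\<lambda>x. x (i :: 'i::finite))"
proof -
  define a0 where "a0 = (\<lambda>j. if j = i then 1 else 0 :: nat)"
  have a0: "a0 \<in> exponents 1" by (simp add: mem_exponents a0_def)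
  have m: "monomial a0 x = x i" for x
  proof -
    have "monomial a0 x = (\<Prod>j\<in>UNIV. if j = i then x j else 1)"
      unfolding monomial_def by (rule prod.cong) (auto simp: a0_def)
    then show ?thesis by simp
  qed
  have "x i = (\<Sum>a\<in>exponents 1. (if a = a0 then 1 else 0) * monomial a x)" for x
  proof -
    have "(\<Sum>a\<in>exponents 1. (if a = a0 then 1 else 0) * monomial a x)
      = (\<Sum>a\<in>exponents 1. if a = a0 then monomial a x else 0)"
      by (rule sum.cong) auto
    then show ?thesis using a0 m by simp
  qed
  then show ?thesis by (rule poly_funI)
qed

lemma poly_fun_add:
  assumes "poly_fun d f" "poly_fun d g"
  shows "poly_fun d (\<lambda>x. f x + g x)"
proof -
  obtain c e where "\<And>x. f x = (\<Sum>a\<in>exponents d. c a * monomial a x)"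
    "\<And>x. g x = (\<Sum>a\<in>exponents d. e a * monomial a x)"
    using assms unfolding poly_fun_def by blast
  then have "f x + g x = (\<Sum>a\<in>exponents d. (c a + e a) * monomial a x)" for x
    by (simp add: sum.distrib distrib_right)
  then show ?thesis by (rule poly_funI)
qed

lemma poly_fun_mult:
  fixes f g :: "('i::finite \<Rightarrow> real) \<Rightarrow> real"
  assumes "poly_fun d f" "poly_fun e g"
  shows "poly_fun (d + e) (\<lambda>x. f x * g x)"
proof -
  obtain c c' where c: "\<And>x. f x = (\<Sum>a\<in>exponents d. c a * monomial a x)"
    "\<And>x. g x = (\<Sum>a\<in>exponents e. c' a * monomial a x)"
    using assms unfolding poly_fun_def by blast
  define s where "s = (\<lambda>(p :: ('i \<Rightarrow> nat) \<times> ('i \<Rightarrow> nat)) i. fst p i + snd p i)"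
  let ?S = "exponents d \<times> exponents e :: (('i \<Rightarrow> nat) \<times> ('i \<Rightarrow> nat)) set"
  define c'' where "c'' = (\<lambda>a. \<Sum>p\<in>{p \<in> ?S. s p = a}. c (fst p) * c' (snd p))"
  have "f x * g x = (\<Sum>a\<in>exponents (d + e). c'' a * monomial a x)" for x
  proof -
    have "f x * g x = (\<Sum>p\<in>?S. c (fst p) * c' (snd p) * monomial (s p) x)"
      unfolding c sum_product
      by (simp add: sum.cartesian_product case_prod_beta s_def monomial_def power_add prod.distrib mult_ac)
    also have "\<dots> = (\<Sum>a\<in>exponents (d + e). \<Sum>p\<in>{p \<in> ?S. s p = a}. c (fst p) * c' (snd p) * monomial (s p) x)"
      by (rule sum.group[symmetric]) (auto simp: mem_exponents s_def sum.distrib intro: add_mono)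
    also have "\<dots> = (\<Sum>a\<in>exponents (d + e). c'' a * monomial a x)"
      by (simp add: c''_def sum_distrib_right)
    finally show ?thesis .
  qed
  then show ?thesis by (rule poly_funI)
qed

lemma poly_fun_cmult: "poly_fun d f \<Longrightarrow> poly_fun d (\<lambda>x. c * f x)"
  using poly_fun_mult[OF poly_fun_const[of 0 c]] by simp

lemma poly_fun_sum:
  assumes "\<And>s. s \<in> S \<Longrightarrow> poly_fun d (f s)"
  shows "poly_fun d (\<lambda>x. \<Sum>s\<in>S. f s x)"
  using assms by (induction S rule: infinite_finite_induct) (auto intro: poly_fun_const poly_fun_add)

lemma poly_fun_prod:
  assumes "\<And>s. s \<in> S \<Longrightarrow> poly_fun (d s) (f s)"
  shows "poly_fun (sum d S) (\<lambda>x. \<Prod>s\<in>S. f s x)"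
  using assms by (induction S rule: infinite_finite_induct) (auto intro: poly_fun_const poly_fun_mult)

text \<open>
  Each term of the Leibniz expansion uses exactly one entry from every column, so degrees that
  are bounded column by column add up.
\<close>

lemma poly_fun_det:
  fixes A :: "('i::finite \<Rightarrow> real) \<Rightarrow> real^'c^'c"
  assumes "\<And>r s. poly_fun (d s) (\<lambda>x. A x $ r $ s)"
  shows "poly_fun (sum d UNIV) (\<lambda>x. det (A x))"
  unfolding det_def
proof (intro poly_fun_sum poly_fun_cmult)
  fix p assume "p \<in> {p. p permutes (UNIV :: 'c set)}"
  then have "(\<Sum>r\<in>UNIV. d (p r)) = sum d UNIV"
    using sum.permute[of p UNIV d] by (simp add: comp_def)
  moreover have "poly_fun (\<Sum>r\<in>UNIV. d (p r)) (\<lambda>x. \<Prod>r\<in>UNIV. A x $ r $ p r)"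
    by (rule poly_fun_prod) (rule assms)
  ultimately show "poly_fun (sum d UNIV) (\<lambda>x. \<Prod>r\<in>UNIV. A x $ r $ p r)" by simp
qed

section \<open>Diagonal dominance and the number of monomials\<close>

text \<open>
  Gaussian elimination: one equation either has only zero coefficients or can be solved for one
  unknown, which removes both the equation and the unknown.
\<close>

lemma homogeneous_system_nontrivial_solution:
  fixes c :: "'s \<Rightarrow> 'e \<Rightarrow> real"
  assumes "finite E" "finite S" "card E < card S"
  shows "\<exists>l. (\<exists>s\<in>S. l s \<noteq> 0) \<and> (\<forall>e\<in>E. (\<Sum>s\<in>S. l s * c s e) = 0)"
  using assms
proof (induction E arbitrary: S c rule: finite_induct)
  case empty
  then have "S \<noteq> {}" by auto
  then show ?case by (intro exI[of _ "\<lambda>_. 1"]) auto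
next
  case (insert e E)
  show ?case
  proof (cases "\<forall>s\<in>S. c s e = 0")
    case True
    obtain l where "\<exists>s\<in>S. l s \<noteq> 0" "\<forall>e\<in>E. (\<Sum>s\<in>S. l s * c s e) = 0"
      using insert.IH[of S c] insert.prems insert.hyps by auto
    with True show ?thesis by (intro exI[of _ l]) auto
  next
    case False
    then obtain s0 where s0: "s0 \<in> S" "c s0 e \<noteq> 0" by blast
    define S' where "S' = S - {s0}"
    define c' where "c' = (\<lambda>s a. c s a - c s e / c s0 e * c s0 a)"
    have "card E < card S'" "finite S'"
      using insert.prems insert.hyps s0 by (auto simp: S'_def)
    then obtain l where l: "\<exists>s\<in>S'. l s \<noteq> 0" "\<And>a. a \<in> E \<Longrightarrow> (\<Sum>s\<in>S'. l s * c' s a) = 0"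
      using insert.IH[of S' c'] by blast
    define l' where "l' = l(s0 := - (\<Sum>s\<in>S'. l s * (c s e / c s0 e)))"
    have eq: "(\<Sum>s\<in>S. l' s * c s a) = (\<Sum>s\<in>S'. l s * c' s a)" for a
    proof -
      have "(\<Sum>s\<in>S'. l' s * c s a) = (\<Sum>s\<in>S'. l s * c s a)"
        by (rule sum.cong) (auto simp: l'_def S'_def)
      then have "(\<Sum>s\<in>S. l' s * c s a)
        = (\<Sum>s\<in>S'. l s * c s a) - (\<Sum>s\<in>S'. l s * (c s e / c s0 e)) * c s0 a"
        using insert.prems s0 by (simp add: sum.remove[of S s0] S'_def[symmetric] l'_def)
      also have "\<dots> = (\<Sum>s\<in>S'. l s * c' s a)"
        by (simp add: c'_def sum_distrib_right sum_subtractf right_diff_distrib mult.assoc)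
      finally show ?thesis .
    qed
    have "\<forall>a\<in>insert e E. (\<Sum>s\<in>S. l' s * c s a) = 0"
      unfolding eq using l(2) s0 by (auto simp: c'_def)
    moreover have "\<exists>s\<in>S. l' s \<noteq> 0"
      using l(1) by (auto simp: l'_def S'_def)
    ultimately show ?thesis by blast
  qed
qed

text \<open>
  More functions than monomials satisfy a nontrivial linear relation with coefficients \<open>l s\<close>.
  Evaluated at the point \<open>x t\<close> with \<open>\<bar>l t\<bar>\<close> maximal, the relation contradicts the dominance of
  the \<open>t\<close>-th function there.
\<close>

lemma card_le_if_diagonally_dominant:
  fixes G :: "'s \<Rightarrow> ('i::finite \<Rightarrow> real) \<Rightarrow> real" and x :: "'s \<Rightarrow> 'i \<Rightarrow> real"
  assumes S: "finite S"
    and poly: "\<And>s. s \<in> S \<Longrightarrow> poly_fun d (G s)"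
    and dom: "\<And>t. t \<in> S \<Longrightarrow> (\<Sum>s\<in>S - {t}. \<bar>G s (x t)\<bar>) < \<bar>G t (x t)\<bar>"
  shows "card S \<le> card (exponents d :: ('i \<Rightarrow> nat) set)"
proof (rule ccontr)
  assume less: "\<not> card S \<le> card (exponents d :: ('i \<Rightarrow> nat) set)"
  have "\<forall>s\<in>S. \<exists>c. \<forall>y. G s y = (\<Sum>a\<in>exponents d. c a * monomial a y)"
    using poly by (simp add: poly_fun_def)
  then obtain c where c: "\<And>s y. s \<in> S \<Longrightarrow> G s y = (\<Sum>a\<in>exponents d. c s a * monomial a y)"
    by metis
  obtain l where l: "\<exists>s\<in>S. l s \<noteq> 0"
    "\<And>a. a \<in> exponents d \<Longrightarrow> (\<Sum>s\<in>S. l s * c s a) = 0"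
    using homogeneous_system_nontrivial_solution[of "exponents d" S c] S less by auto
  have vanish: "(\<Sum>s\<in>S. l s * G s y) = 0" for y
  proof -
    have "(\<Sum>s\<in>S. l s * G s y) = (\<Sum>s\<in>S. \<Sum>a\<in>exponents d. l s * c s a * monomial a y)"
      by (rule sum.cong) (auto simp: c sum_distrib_left mult.assoc)
    also have "\<dots> = (\<Sum>a\<in>exponents d. (\<Sum>s\<in>S. l s * c s a) * monomial a y)"
      by (subst sum.swap) (simp add: sum_distrib_right)
    finally show ?thesis using l(2) by simp
  qed
  have "S \<noteq> {}" using l(1) by auto
  then have "Max ((\<lambda>s. \<bar>l s\<bar>) ` S) \<in> (\<lambda>s. \<bar>l s\<bar>) ` S"
    using S by (intro Max_in) auto
  then obtain t where "t \<in> S" and Max: "Max ((\<lambda>s. \<bar>l s\<bar>) ` S) = \<bar>l t\<bar>" by auto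
  then have t: "t \<in> S" "\<And>s. s \<in> S \<Longrightarrow> \<bar>l s\<bar> \<le> \<bar>l t\<bar>"
    using S by (auto simp flip: Max)
  have "\<bar>l t\<bar> > 0" using l(1) t(2) by force
  have "\<bar>l t\<bar> * \<bar>G t (x t)\<bar> = \<bar>\<Sum>s\<in>S - {t}. l s * G s (x t)\<bar>"
    using vanish[of "x t"] S t(1) by (simp add: sum.remove[of S t] abs_mult[symmetric] add_eq_0_iff)
  also have "\<dots> \<le> (\<Sum>s\<in>S - {t}. \<bar>l s\<bar> * \<bar>G s (x t)\<bar>)"
    by (rule order_trans[OF sum_abs]) (simp add: abs_mult)
  also have "\<dots> \<le> (\<Sum>s\<in>S - {t}. \<bar>l t\<bar> * \<bar>G s (x t)\<bar>)"
    using t by (intro sum_mono mult_right_mono) auto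
  also have "\<dots> = \<bar>l t\<bar> * (\<Sum>s\<in>S - {t}. \<bar>G s (x t)\<bar>)"
    by (simp add: sum_distrib_left)
  also have "\<dots> < \<bar>l t\<bar> * \<bar>G t (x t)\<bar>"
    using dom[OF t(1)] \<open>\<bar>l t\<bar> > 0\<close> by simp
  finally show False by simp
qed

section \<open>Chebyshev polynomials\<close>

fun chebyshev :: "nat \<Rightarrow> real \<Rightarrow> real" where
  "chebyshev 0 x = 1"
| "chebyshev (Suc 0) x = x"
| "chebyshev (Suc (Suc k)) x = 2 * x * chebyshev (Suc k) x - chebyshev k x"

lemma chebyshev_cos: "chebyshev k (cos t) = cos (real k * t)"
proof (induction k "cos t" rule: chebyshev.induct)
  case (3 k)
  have "cos (real (Suc k) * t + t) + cos (real (Suc k) * t - t) = 2 * cos t * cos (real (Suc k) * t)"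
    by (simp add: cos_add cos_diff)
  moreover have "real (Suc k) * t + t = real (Suc (Suc k)) * t" "real (Suc k) * t - t = real k * t"
    by (simp_all add: algebra_simps)
  ultimately show ?case using 3 by simp
qed simp_all

lemma abs_chebyshev_le_1: "\<bar>x\<bar> \<le> 1 \<Longrightarrow> \<bar>chebyshev k x\<bar> \<le> 1"
  by (metis abs_cos_le_one chebyshev_cos cos_arccos_abs)

text \<open>
  This form, which is \<open>cosh (k * s)\<close> at \<open>cosh s\<close> with \<open>z = exp s\<close>, shows the exponential growth in
  \<open>k\<close> outside the interval on which the polynomials stay bounded by 1.
\<close>

lemma chebyshev_joukowski:
  assumes "z \<noteq> 0"
  shows "chebyshev k ((z + 1 / z) / 2) = (z ^ k + 1 / z ^ k) / 2"
  using assms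
proof (induction k rule: induct_nat_012)
  case (ge2 k)
  have "chebyshev (Suc (Suc k)) ((z + 1 / z) / 2)
    = (z + 1 / z) * ((z ^ Suc k + 1 / z ^ Suc k) / 2) - (z ^ k + 1 / z ^ k) / 2"
    unfolding ge2(1)[OF ge2(3), symmetric] ge2(2)[OF ge2(3), symmetric] by simp
  also have "\<dots> = (z ^ Suc (Suc k) + 1 / z ^ Suc (Suc k)) / 2"
    using ge2(3) by (simp add: field_simps)
  finally show ?case .
qed simp_all

lemma isCont_chebyshev: "isCont (chebyshev k) x"
by (induction k x rule: chebyshev.induct) (auto intro!: continuous_intros)

text \<open>
  A Chebyshev polynomial of degree \<open>k\<close> in a quotient \<open>h / g\<close> becomes a polynomial after
  multiplication by \<open>g ^ k\<close>; the three-term recursion is homogenised accordingly.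
\<close>

lemma poly_fun_chebyshev_homogenized:
  assumes h: "poly_fun d h" and g: "poly_fun d g"
  shows "\<exists>G. poly_fun (k * d) G \<and> (\<forall>x. g x \<noteq> 0 \<longrightarrow> G x = g x ^ k * chebyshev k (h x / g x))"
proof (induction k rule: induct_nat_012)
  case 0
  show ?case by (intro exI[of _ "\<lambda>_. 1"]) (simp add: poly_fun_const)
next
  case 1
  show ?case by (intro exI[of _ h]) (simp add: h)
next
  case (ge2 k)
  then obtain G0 G1 where G:
    "poly_fun (k * d) G0" "\<And>x. g x \<noteq> 0 \<Longrightarrow> G0 x = g x ^ k * chebyshev k (h x / g x)"
    "poly_fun (Suc k * d) G1" "\<And>x. g x \<noteq> 0 \<Longrightarrow> G1 x = g x ^ Suc k * chebyshev (Suc k) (h x / g x)"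
    by blast
  have "poly_fun (d + Suc k * d) (\<lambda>x. 2 * (h x * G1 x))"
    by (intro poly_fun_cmult poly_fun_mult h G)
  moreover have "poly_fun ((d + d) + k * d) (\<lambda>x. (-1) * ((g x * g x) * G0 x))"
    by (intro poly_fun_cmult poly_fun_mult g G)
  ultimately have "poly_fun (Suc (Suc k) * d) (\<lambda>x. 2 * (h x * G1 x) + (-1) * ((g x * g x) * G0 x))"
    by (intro poly_fun_add) (simp_all add: add.assoc)
  moreover have "2 * (h x * G1 x) + (-1) * ((g x * g x) * G0 x)
      = g x ^ Suc (Suc k) * chebyshev (Suc (Suc k)) (h x / g x)" if "g x \<noteq> 0" for x
    using that by (simp add: G field_simps)
  ultimately show ?case by (intro exI conjI allI impI)
qed

section \<open>Distances between orthogonal projections\<close>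

lemma norm_sq_eq_sum_columns:
  fixes A :: "real^'n^'m"
  shows "(norm A)\<^sup>2 = (\<Sum>j\<in>UNIV. (norm (column j A))\<^sup>2)"
  unfolding power2_norm_eq_inner inner_vec_def column_def
  by (subst sum.swap) simp

lemma column_eq_mult_axis:
  fixes P :: "real^'n^'m"
  shows "column j P = P *v axis j 1"
  by (simp add: matrix_vector_mult_basis)

lemma orth_proj_norm_sq:
  assumes "is_orth_proj_matrix S P"
  shows "(norm (P *v e))\<^sup>2 = inner (P *v e) e"
proof -
  have "inner (P *v e) (e - P *v e) = 0"
    using assms unfolding is_orth_proj_matrix_def orthogonal_comp_def orthogonal_def by blast
  then show ?thesis by (simp add: inner_diff_right power2_norm_eq_inner)
qed

text \<open>
  The projections of \<open>e\<close> onto all subspaces lie on one sphere, with diameter from 0 to \<open>e\<close>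
  (Thales). Hence any two of them are at distance at most \<open>norm e\<close>, without the factor 2 of the
  triangle inequality through 0.
\<close>

lemma dist_orth_proj_half:
  assumes "is_orth_proj_matrix S P"
  shows "dist (P *v e) ((1/2) *\<^sub>R e) = norm e / 2"
proof -
  have "(dist (P *v e) ((1/2) *\<^sub>R e))\<^sup>2 = (norm (P *v e))\<^sup>2 - inner (P *v e) e + (norm e / 2)\<^sup>2"
    by (simp add: dist_norm power_divide power2_norm_eq_inner inner_diff_left inner_diff_right
        inner_commute)
  also have "\<dots> = (norm e / 2)\<^sup>2" using orth_proj_norm_sq[OF assms, of e] by simp
  finally show ?thesis by simp
qed

lemma inner_self_orth_proj:
  assumes "is_orth_proj_matrix S P"
  shows "inner P P = trace P"
proof -
  have "(norm (column j P))\<^sup>2 = P $ j $ j" for j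
    unfolding column_eq_mult_axis orth_proj_norm_sq[OF assms]
    by (simp add: inner_axis matrix_vector_mult_basis column_def)
  then show ?thesis
    by (simp add: power2_norm_eq_inner[symmetric] norm_sq_eq_sum_columns trace_def)
qed

text \<open>
  Since a projection satisfies \<open>inner P P = trace P\<close>, the quadratic terms disappear: for fixed
  \<open>P\<close>, the squared distance is an affine function of \<open>Q\<close>. Composition with a rational function
  therefore does not double its degree.
\<close>

lemma dist_sq_orth_proj:
  assumes "is_orth_proj_matrix S P" "is_orth_proj_matrix T Q"
  shows "(dist P Q)\<^sup>2 = trace P + trace Q - 2 * inner P Q"
  unfolding dist_norm power2_norm_eq_inner
  by (simp add: inner_diff_left inner_diff_right inner_commute
      inner_self_orth_proj[OF assms(1)] inner_self_orth_proj[OF assms(2)])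

lemma dist_orth_proj_le:
  fixes P Q :: "real^'n^'n"
  assumes "is_orth_proj_matrix S P" "is_orth_proj_matrix T Q"
  shows "dist P Q \<le> real CARD('n)"
proof -
  have "norm (column j (P - Q)) \<le> 1" for j
  proof -
    have "dist (P *v axis j 1) (Q *v axis j 1) \<le> 1"
      using dist_triangle2[of "P *v axis j 1" "Q *v axis j 1" "(1/2) *\<^sub>R axis j 1"]
      by (simp add: dist_orth_proj_half[OF assms(1)] dist_orth_proj_half[OF assms(2)])
    then show ?thesis
      by (simp add: column_eq_mult_axis dist_norm matrix_vector_mult_diff_rdistrib)
  qed
  then have "(norm (P - Q))\<^sup>2 \<le> (\<Sum>j\<in>(UNIV :: 'n set). 1\<^sup>2)"
    unfolding norm_sq_eq_sum_columns by (intro sum_mono power_mono) auto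
  also have "\<dots> \<le> (real CARD('n))\<^sup>2" by (simp add: power2_eq_square)
  finally show ?thesis
    unfolding dist_norm by (rule power2_le_imp_le) simp
qed

lemma abs_orth_proj_entry_le_1:
  assumes "is_orth_proj_matrix S P"
  shows "\<bar>P $ i $ j\<bar> \<le> 1"
proof -
  have "norm (P *v axis j 1) \<le> 1"
    using dist_orth_proj_half[OF assms, of "axis j 1"]
      norm_triangle_sub[of "P *v axis j 1" "(1/2) *\<^sub>R axis j 1"]
    by (simp add: dist_norm)
  moreover have "\<bar>(P *v axis j 1) $ i\<bar> \<le> norm (P *v axis j 1)"
    by (rule component_le_norm_cart)
  ultimately show ?thesis by (simp add: matrix_vector_mult_basis column_def)
qed

section \<open>Rational approximation of projections\<close>

text \<open>
  The projection onto the column space of \<open>A\<close> is a discontinuous function of \<open>A\<close> where the rank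
  drops. Regularised least squares, \<open>A ** matrix_inv (transpose A ** A + t *\<^sub>R mat 1) ** transpose A\<close>,
  is defined for every \<open>A\<close> when \<open>t > 0\<close>, tends to the projection as \<open>t\<close> decreases to 0, and has
  entries that are quotients of polynomials in the entries of \<open>A\<close>.
\<close>

definition tikhonov_gram :: "real^'c^'n \<Rightarrow> real \<Rightarrow> real^'c^'c"
  where "tikhonov_gram A t = transpose A ** A + t *\<^sub>R mat 1"

text \<open>
  The \<open>(i, j)\<close> entry of the regularised projection, multiplied by the determinant of the
  regularised Gram matrix and written with Cramer's rule.
\<close>

definition tikhonov_numerator :: "real^'c^'n \<Rightarrow> real \<Rightarrow> 'n \<Rightarrow> 'n \<Rightarrow> real"
  where "tikhonov_numerator A t i j =
    (\<Sum>c\<in>UNIV. A $ i $ c * det (\<chi> r s. if s = c then A $ j $ r else tikhonov_gram A t $ r $ s))"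

lemma tikhonov_gram_mult:
  "tikhonov_gram A t *v u = transpose A *v (A *v u) + t *\<^sub>R u"
  by (simp add: tikhonov_gram_def matrix_vector_mult_add_rdistrib matrix_vector_mul_assoc
      scaleR_matrix_vector_assoc[symmetric])

lemma inner_tikhonov_gram:
  fixes A :: "real^'c^'n"
  shows "inner u (tikhonov_gram A t *v u) = (norm (A *v u))\<^sup>2 + t * (norm u)\<^sup>2"
proof -
  have "inner u (transpose A *v (A *v u)) = inner (A *v u) (A *v u)"
    using dot_lmul_matrix[of "A *v u" A u]
    by (simp add: transpose_matrix_vector inner_commute)
  then show ?thesis
    by (simp add: tikhonov_gram_mult inner_add_right power2_norm_eq_inner)
qed

lemma det_tikhonov_gram_nonzero:
  assumes "0 < t"
  shows "det (tikhonov_gram A t) \<noteq> 0"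
proof -
  have "u = 0" if "tikhonov_gram A t *v u = 0" for u
  proof -
    have "(norm (A *v u))\<^sup>2 + t * (norm u)\<^sup>2 = 0"
      using inner_tikhonov_gram[of u A t] that by simp
    then have "t * (norm u)\<^sup>2 = 0"
      using assms by (smt (verit) mult_nonneg_nonneg zero_le_power2)
    then show ?thesis using assms by simp
  qed
  then show ?thesis
    by (simp add: invertible_det_nz[symmetric] invertible_left_inverse matrix_left_invertible_ker)
qed

text \<open>
  Write the projection of the basis vector \<open>e\<close> as \<open>A *v u\<close> and let \<open>v\<close> be the regularised
  solution. The normal equations give \<open>tikhonov_gram A t *v (v - u) = - (t *\<^sub>R u)\<close>. Pairing this with
  \<open>v - u\<close> bounds first \<open>norm (v - u)\<close> by \<open>norm u\<close> and then \<open>norm (A *v (v - u))\<close> by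
  \<open>sqrt t * norm u\<close>, whatever the rank of \<open>A\<close>.
\<close>

lemma tikhonov_tendsto_orth_proj:
  fixes A :: "real^'c^'n"
  assumes P: "is_orth_proj_matrix (span (columns A)) P"
  shows "((\<lambda>t. tikhonov_numerator A t i j / det (tikhonov_gram A t)) \<longlongrightarrow> P $ i $ j) (at_right 0)"
proof -
  define e where "e = (axis j 1 :: real^'n)"
  have "P *v e \<in> span (columns A)" and perp: "e - P *v e \<in> (span (columns A))\<^sup>\<bottom>"
    using P by (auto simp: is_orth_proj_matrix_def)
  moreover have "span (columns A) = range ((*v) A)"
  proof
    show "span (columns A) \<subseteq> range ((*v) A)"
      by (rule span_minimal)
        (auto simp: columns_image_basis intro: linear_subspace_image matrix_vector_mul_linear)
  qed (auto intro: matrix_vector_mult_in_columnspace)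
  ultimately obtain u where u: "P *v e = A *v u" by auto
  have "inner y (transpose A *v (e - A *v u)) = 0" for y
  proof -
    have "inner (e - A *v u) (A *v y) = 0"
      using perp matrix_vector_mult_in_columnspace[of A y]
      by (auto simp: u orthogonal_comp_def orthogonal_def inner_commute)
    then show ?thesis
      using dot_lmul_matrix[of "e - A *v u" A y] by (simp add: transpose_matrix_vector inner_commute)
  qed
  then have normal: "transpose A *v (A *v u) = transpose A *v e"
    by (metis (no_types) inner_eq_zero_iff matrix_vector_mult_diff_distrib eq_iff_diff_eq_0)
  have row: "transpose A *v e = A $ j"
    by (simp add: e_def matrix_vector_mult_basis column_transpose row_def)
  have bound: "norm (tikhonov_numerator A t i j / det (tikhonov_gram A t) - P $ i $ j)
      \<le> sqrt t * norm u" if t: "0 < t" for t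
  proof -
    define M where "M = tikhonov_gram A t"
    define v where "v = (\<chi> c. det (\<chi> r s. if s = c then A $ j $ r else M $ r $ s) / det M)"
    have Mv: "M *v v = A $ j"
      using cramer[of M v "A $ j"] det_tikhonov_gram_nonzero[OF t, of A] by (simp add: M_def v_def)
    have num: "tikhonov_numerator A t i j / det M = (A *v v) $ i"
      unfolding tikhonov_numerator_def v_def M_def matrix_vector_mult_def
      by (simp add: sum_divide_distrib)
    define w where "w = v - u"
    have "M *v w = - (t *\<^sub>R u)"
    proof -
      have "M *v u = A $ j + t *\<^sub>R u"
        using normal row by (simp add: M_def tikhonov_gram_mult)
      then show ?thesis by (simp add: w_def matrix_vector_mult_diff_distrib Mv)
    qed
    then have "(norm (A *v w))\<^sup>2 + t * (norm w)\<^sup>2 = - (t * inner w u)"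
      using inner_tikhonov_gram[of w A t] by (simp add: M_def)
    also have "\<dots> \<le> t * (norm w * norm u)"
    proof -
      have "- inner w u \<le> norm w * norm u" using Cauchy_Schwarz_ineq2[of w u] by linarith
      then show ?thesis using mult_left_mono[of "- inner w u" _ t] t by simp
    qed
    finally have main: "(norm (A *v w))\<^sup>2 + t * (norm w)\<^sup>2 \<le> t * (norm w * norm u)" .
    then have "t * (norm w)\<^sup>2 \<le> t * (norm w * norm u)"
      by (smt (verit) zero_le_power2)
    then have "norm w * norm w \<le> norm w * norm u"
      using t by (simp add: power2_eq_square)
    then have "norm w \<le> norm u"
      by (cases "w = 0") auto
    have "0 \<le> t * (norm w)\<^sup>2" using t by simp
    with main have "(norm (A *v w))\<^sup>2 \<le> t * (norm w * norm u)" by linarith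
    also have "\<dots> \<le> t * (norm u * norm u)"
      using \<open>norm w \<le> norm u\<close> t by (intro mult_left_mono mult_right_mono) auto
    also have "\<dots> = (sqrt t * norm u)\<^sup>2"
      using t by (simp add: power_mult_distrib) (simp add: power2_eq_square)
    finally have "norm (A *v w) \<le> sqrt t * norm u"
      by (rule power2_le_imp_le) (use t in simp)
    moreover have "tikhonov_numerator A t i j / det M - P $ i $ j = (A *v w) $ i"
    proof -
      have "P $ i $ j = (A *v u) $ i"
        by (simp flip: u add: e_def matrix_vector_mult_basis column_def)
      then show ?thesis by (simp add: num w_def matrix_vector_mult_diff_distrib)
    qed
    ultimately show ?thesis
      using component_le_norm_cart[of "A *v w" i] by (simp add: M_def)
  qed
  have "((\<lambda>t. sqrt t * norm u) \<longlongrightarrow> sqrt 0 * norm u) (at_right 0)"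
    by (intro tendsto_intros)
  then have null: "((\<lambda>t. sqrt t * norm u) \<longlongrightarrow> 0) (at_right 0)" by simp
  have "\<forall>\<^sub>F t in at_right 0.
      norm (tikhonov_numerator A t i j / det (tikhonov_gram A t) - P $ i $ j) \<le> sqrt t * norm u"
    using eventually_at_right_less[of "0 :: real"] by (rule eventually_mono) (rule bound)
  from Lim_null_comparison[OF this null] show ?thesis by (simp add: LIM_zero_iff)
qed

lemma poly_fun_tikhonov_gram:
  fixes A :: "('i::finite \<Rightarrow> real) \<Rightarrow> real^'c^'n"
  assumes "\<And>i c. poly_fun 1 (\<lambda>x. A x $ i $ c)"
  shows "poly_fun 2 (\<lambda>x. tikhonov_gram (A x) t $ r $ s)"
proof -
  have "poly_fun (1 + 1) (\<lambda>x. (\<Sum>k\<in>UNIV. A x $ k $ r * A x $ k $ s) + t * (mat 1 :: real^'c^'c) $ r $ s)"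
    by (intro poly_fun_add poly_fun_sum poly_fun_mult assms poly_fun_const)
  then show ?thesis
    by (simp add: tikhonov_gram_def matrix_matrix_mult_def transpose_def numeral_2_eq_2)
qed

lemma poly_fun_det_tikhonov_gram:
  fixes A :: "('i::finite \<Rightarrow> real) \<Rightarrow> real^'c^'n"
  assumes "\<And>i c. poly_fun 1 (\<lambda>x. A x $ i $ c)"
  shows "poly_fun (2 * CARD('c)) (\<lambda>x. det (tikhonov_gram (A x) t))"
  using poly_fun_det[of "\<lambda>_. 2", OF poly_fun_tikhonov_gram[OF assms]] by (simp add: mult.commute)

text \<open>
  In Cramer's rule the replaced column has degree 1 instead of 2; this saves exactly the degree
  of the factor \<open>A $ i $ c\<close>, so that numerators and denominator have the same degree bound.
\<close>

lemma poly_fun_tikhonov_numerator: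
  fixes A :: "('i::finite \<Rightarrow> real) \<Rightarrow> real^'c^'n"
  assumes A: "\<And>i c. poly_fun 1 (\<lambda>x. A x $ i $ c)"
  shows "poly_fun (2 * CARD('c)) (\<lambda>x. tikhonov_numerator (A x) t i j)"
  unfolding tikhonov_numerator_def
proof (rule poly_fun_sum)
  fix c :: 'c
  define d where "d = (\<lambda>s. if s = c then 1 else 2 :: nat)"
  have "poly_fun (sum d UNIV)
      (\<lambda>x. det (\<chi> r s. if s = c then A x $ j $ r else tikhonov_gram (A x) t $ r $ s))"
    by (rule poly_fun_det) (use A in \<open>simp add: d_def poly_fun_tikhonov_gram\<close>)
  then have "poly_fun (1 + sum d UNIV) (\<lambda>x. A x $ i $ c *
      det (\<chi> r s. if s = c then A x $ j $ r else tikhonov_gram (A x) t $ r $ s))"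
    by (intro poly_fun_mult A)
  moreover have "1 + sum d UNIV = 2 * CARD('c)"
  proof -
    have "sum d (UNIV - {c}) = (\<Sum>s\<in>UNIV - {c}. 2)"
      by (rule sum.cong) (auto simp: d_def)
    also have "\<dots> = 2 * (CARD('c) - 1)" by (simp add: card_Diff_singleton)
    finally have "sum d UNIV = 1 + 2 * (CARD('c) - 1)"
      using sum.remove[of UNIV c d] by (simp add: d_def)
    moreover have "1 \<le> CARD('c)" by (simp add: Suc_le_eq)
    ultimately show ?thesis by linarith
  qed
  ultimately show "poly_fun (2 * CARD('c)) (\<lambda>x. A x $ i $ c *
      det (\<chi> r s. if s = c then A x $ j $ r else tikhonov_gram (A x) t $ r $ s))" by simp
qed

section \<open>Packing bounds for families of projections\<close>

text \<open>
  The affine map \<open>l\<close> sends the range \<open>{\<epsilon>\<^sup>2..n\<^sup>2}\<close> of squared distances between distinct points of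
  \<open>S\<close> onto \<open>{-1..1}\<close>, and 0 to \<open>(z + 1 / z) / 2\<close>. A Chebyshev polynomial of \<open>l ((dist P Q)\<^sup>2)\<close>
  is thus at most 1 in absolute value for \<open>P \<noteq> Q\<close> and larger than \<open>card S - 1\<close> for \<open>P = Q\<close>, which
  is diagonal dominance. Dominance is an open condition, so it survives when the projections \<open>Q\<close>
  are replaced by their regularisations for some small \<open>t > 0\<close>; after clearing denominators the
  functions of the parameter are polynomials of degree \<open>k * (2 * CARD('c))\<close>.
\<close>

lemma card_separated_orth_proj_le:
  fixes A :: "('i::finite \<Rightarrow> real) \<Rightarrow> real^'c^'n"
  assumes poly: "\<And>i c. poly_fun 1 (\<lambda>x. A x $ i $ c)"
    and S: "finite S" "S \<subseteq> range (\<lambda>x. orth_proj_matrix (span (columns (A x))))"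
    and sep: "pairwise (\<lambda>P Q. \<epsilon> < dist P Q) S"
    and \<epsilon>: "0 < \<epsilon>" "\<epsilon> < real CARD('n)"
    and z: "z = (1 + \<epsilon> / real CARD('n)) / (1 - \<epsilon> / real CARD('n))"
    and card: "real (card S) - 1 \<le> z ^ k / 2"
  shows "card S \<le> card (exponents (k * (2 * CARD('c))) :: ('i \<Rightarrow> nat) set)"
proof -
  define n where "n = real CARD('n)"
  define y where "y = \<epsilon> / n"
  have y: "0 < y" "y < 1" "z = (1 + y) / (1 - y)" and n: "0 < n" "\<epsilon> < n"
    using \<epsilon> by (auto simp: y_def n_def z)
  have "0 < z" using y by simp
  define l where "l = (\<lambda>s. (n\<^sup>2 + \<epsilon>\<^sup>2 - 2 * s) / (n\<^sup>2 - \<epsilon>\<^sup>2))"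
  have width: "0 < n\<^sup>2 - \<epsilon>\<^sup>2" using \<epsilon>(1) n by (simp add: power_strict_mono)
  have l0: "l 0 = (z + 1 / z) / 2"
  proof -
    have "l 0 = (1 + y\<^sup>2) / (1 - y\<^sup>2)"
    proof -
      have "1 + y\<^sup>2 = (n\<^sup>2 + \<epsilon>\<^sup>2) / n\<^sup>2" "1 - y\<^sup>2 = (n\<^sup>2 - \<epsilon>\<^sup>2) / n\<^sup>2"
        using n by (simp_all add: y_def field_simps)
      then show ?thesis using n by (simp add: l_def)
    qed
    also have "\<dots> = (z + 1 / z) / 2"
    proof -
      have "1 - y\<^sup>2 = (1 - y) * (1 + y)" by (simp add: power2_eq_square algebra_simps)
      then show ?thesis
        using y(1,2) unfolding y(3) by (simp add: divide_simps) (simp add: power2_eq_square algebra_simps)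
    qed
    finally show ?thesis .
  qed
  have peak: "real (card S) - 1 < \<bar>chebyshev k (l 0)\<bar>"
  proof -
    have "chebyshev k (l 0) = (z ^ k + 1 / z ^ k) / 2"
      using \<open>0 < z\<close> unfolding l0 by (intro chebyshev_joukowski) simp
    moreover have "z ^ k / 2 < (z ^ k + 1 / z ^ k) / 2" using \<open>0 < z\<close> by simp
    ultimately show ?thesis using card by linarith
  qed
  have "\<forall>P\<in>S. \<exists>x. P = orth_proj_matrix (span (columns (A x)))" using S(2) by blast
  then obtain x where x: "\<And>P. P \<in> S \<Longrightarrow> P = orth_proj_matrix (span (columns (A (x P))))" by metis
  then have proj: "is_orth_proj_matrix (span (columns (A (x P)))) P" if "P \<in> S" for P
    using is_orth_proj_matrix_orth_proj_matrix[OF subspace_span] that by metis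
  have small: "\<bar>chebyshev k (l ((dist P Q)\<^sup>2))\<bar> \<le> 1" if "P \<in> S" "Q \<in> S" "P \<noteq> Q" for P Q
  proof -
    have "\<epsilon> < dist P Q" using sep that by (auto simp: pairwise_def)
    then have "\<epsilon>\<^sup>2 \<le> (dist P Q)\<^sup>2" using \<epsilon>(1) by (intro power_mono) auto
    moreover have "(dist P Q)\<^sup>2 \<le> n\<^sup>2"
      using dist_orth_proj_le[OF proj proj] that by (intro power_mono) (auto simp: n_def)
    ultimately have "\<bar>l ((dist P Q)\<^sup>2)\<bar> \<le> 1"
      using width by (simp add: l_def abs_le_iff divide_simps)
    then show ?thesis by (rule abs_chebyshev_le_1)
  qed
  \<comment> \<open>\<open>h P t v\<close> is the determinant times \<open>l (trace P + trace B - 2 * inner P B)\<close>, where \<open>B\<close> is the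
    regularised projection for the parameter \<open>v\<close>.\<close>
  define h where "h = (\<lambda>P t v. l (trace P) * det (tikhonov_gram (A v) t)
     + (\<Sum>i\<in>UNIV. \<Sum>j\<in>UNIV. - (2 / (n\<^sup>2 - \<epsilon>\<^sup>2) * ((if i = j then 1 else 0) - 2 * P $ i $ j))
         * tikhonov_numerator (A v) t i j))"
  define \<rho> where "\<rho> = (\<lambda>t P Q. h P t (x Q) / det (tikhonov_gram (A (x Q)) t))"
  have poly_h: "poly_fun (2 * CARD('c)) (h P t)" for P t
    unfolding h_def
    by (intro poly_fun_add poly_fun_sum poly_fun_cmult poly_fun_det_tikhonov_gram
        poly_fun_tikhonov_numerator poly)
  have lim: "((\<lambda>t. \<rho> t P Q) \<longlongrightarrow> l ((dist P Q)\<^sup>2)) (at_right 0)" if PQ: "P \<in> S" "Q \<in> S" for P Q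
  proof -
    let ?c = "\<lambda>i j. - (2 / (n\<^sup>2 - \<epsilon>\<^sup>2) * ((if i = j then 1 else 0) - 2 * P $ i $ j))"
    have approx: "((\<lambda>t. l (trace P) + (\<Sum>i\<in>UNIV. \<Sum>j\<in>UNIV. ?c i j *
          (tikhonov_numerator (A (x Q)) t i j / det (tikhonov_gram (A (x Q)) t))))
        \<longlongrightarrow> l (trace P) + (\<Sum>i\<in>UNIV. \<Sum>j\<in>UNIV. ?c i j * Q $ i $ j)) (at_right 0)"
      by (intro tendsto_intros tikhonov_tendsto_orth_proj proj PQ)
    have rational: "\<forall>\<^sub>F t in at_right 0. l (trace P) + (\<Sum>i\<in>UNIV. \<Sum>j\<in>UNIV. ?c i j *
          (tikhonov_numerator (A (x Q)) t i j / det (tikhonov_gram (A (x Q)) t))) = \<rho> t P Q"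
    proof (rule eventually_mono[OF eventually_at_right_less[of 0]])
      fix t :: real assume "0 < t"
      then have "det (tikhonov_gram (A (x Q)) t) \<noteq> 0" by (rule det_tikhonov_gram_nonzero)
      then show "l (trace P) + (\<Sum>i\<in>UNIV. \<Sum>j\<in>UNIV. ?c i j *
          (tikhonov_numerator (A (x Q)) t i j / det (tikhonov_gram (A (x Q)) t))) = \<rho> t P Q"
        by (simp add: \<rho>_def h_def add_divide_distrib sum_divide_distrib)
    qed
    have limit: "l (trace P) + (\<Sum>i\<in>UNIV. \<Sum>j\<in>UNIV. ?c i j * Q $ i $ j) = l ((dist P Q)\<^sup>2)"
    proof -
      have "(\<Sum>i\<in>UNIV. \<Sum>j\<in>UNIV. ?c i j * Q $ i $ j)
        = (\<Sum>i\<in>UNIV. \<Sum>j\<in>UNIV. - (2 / (n\<^sup>2 - \<epsilon>\<^sup>2)) *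
            ((if i = j then Q $ i $ j else 0) - 2 * (P $ i $ j * Q $ i $ j)))"
        by (intro sum.cong) (auto simp: algebra_simps)
      also have "\<dots> = - (2 / (n\<^sup>2 - \<epsilon>\<^sup>2)) * (trace Q - 2 * inner P Q)"
        by (simp only: sum_distrib_left[symmetric] sum_subtractf) (simp add: trace_def inner_vec_def)
      finally have "l (trace P) + (\<Sum>i\<in>UNIV. \<Sum>j\<in>UNIV. ?c i j * Q $ i $ j)
        = l (trace P) + - (2 / (n\<^sup>2 - \<epsilon>\<^sup>2)) * (trace Q - 2 * inner P Q)"
        by (rule arg_cong)
      also have "\<dots> = l (trace P + (trace Q - 2 * inner P Q))"
        unfolding l_def distrib_left diff_divide_distrib add_divide_distrib by simp
      finally show ?thesis
        unfolding dist_sq_orth_proj[OF proj proj, OF PQ] by (simp add: add_diff_eq)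
    qed
    show ?thesis
      using Lim_transform_eventually[OF approx rational] unfolding limit .
  qed
  have "\<forall>\<^sub>F t in at_right 0. (\<Sum>P\<in>S - {Q}. \<bar>chebyshev k (\<rho> t P Q)\<bar>) < \<bar>chebyshev k (\<rho> t Q Q)\<bar>"
    if Q: "Q \<in> S" for Q
  proof -
    have "((\<lambda>t. \<bar>chebyshev k (\<rho> t Q Q)\<bar> - (\<Sum>P\<in>S - {Q}. \<bar>chebyshev k (\<rho> t P Q)\<bar>))
      \<longlongrightarrow> \<bar>chebyshev k (l ((dist Q Q)\<^sup>2))\<bar> - (\<Sum>P\<in>S - {Q}. \<bar>chebyshev k (l ((dist P Q)\<^sup>2))\<bar>)) (at_right 0)"
      using Q by (intro tendsto_intros isCont_tendsto_compose[OF isCont_chebyshev] lim) auto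
    moreover have "0 < \<bar>chebyshev k (l ((dist Q Q)\<^sup>2))\<bar> - (\<Sum>P\<in>S - {Q}. \<bar>chebyshev k (l ((dist P Q)\<^sup>2))\<bar>)"
    proof -
      have "(\<Sum>P\<in>S - {Q}. \<bar>chebyshev k (l ((dist P Q)\<^sup>2))\<bar>) \<le> real (card (S - {Q})) * 1"
        using small Q by (intro sum_bounded_above) auto
      also have "\<dots> = real (card S) - 1"
        using Q card_Suc_Diff1[OF S(1) Q] by linarith
      finally show ?thesis using peak by simp
    qed
    ultimately have "\<forall>\<^sub>F t in at_right 0.
        0 < \<bar>chebyshev k (\<rho> t Q Q)\<bar> - (\<Sum>P\<in>S - {Q}. \<bar>chebyshev k (\<rho> t P Q)\<bar>)"
      by (rule order_tendstoD(1))
    then show ?thesis by simp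
  qed
  then have "\<forall>\<^sub>F t in at_right 0. 0 < t \<and>
      (\<forall>Q\<in>S. (\<Sum>P\<in>S - {Q}. \<bar>chebyshev k (\<rho> t P Q)\<bar>) < \<bar>chebyshev k (\<rho> t Q Q)\<bar>)"
    by (intro eventually_conj eventually_at_right_less eventually_ball_finite S(1)) blast
  then have "\<exists>t. 0 < t \<and>
      (\<forall>Q\<in>S. (\<Sum>P\<in>S - {Q}. \<bar>chebyshev k (\<rho> t P Q)\<bar>) < \<bar>chebyshev k (\<rho> t Q Q)\<bar>)"
    by (rule eventually_happens'[OF trivial_limit_at_right_real])
  then obtain t where t: "0 < t"
    and dom: "\<And>Q. Q \<in> S \<Longrightarrow> (\<Sum>P\<in>S - {Q}. \<bar>chebyshev k (\<rho> t P Q)\<bar>) < \<bar>chebyshev k (\<rho> t Q Q)\<bar>"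
    by blast
  define g where "g = (\<lambda>v. det (tikhonov_gram (A v) t))"
  have g: "g v \<noteq> 0" for v using det_tikhonov_gram_nonzero[OF t] by (simp add: g_def)
  have "\<exists>G. poly_fun (k * (2 * CARD('c))) G \<and> (\<forall>v. G v = g v ^ k * chebyshev k (h P t v / g v))" for P
    using poly_fun_chebyshev_homogenized[OF poly_h[of P t] poly_fun_det_tikhonov_gram[OF poly, of t], of k] g
    unfolding g_def by blast
  then obtain G where G: "\<And>P. poly_fun (k * (2 * CARD('c))) (G P)"
    "\<And>P v. G P v = g v ^ k * chebyshev k (h P t v / g v)" by metis
  show ?thesis
  proof (rule card_le_if_diagonally_dominant[OF S(1) G(1)])
    fix Q assume Q: "Q \<in> S"
    have "\<bar>G P (x Q)\<bar> = \<bar>g (x Q)\<bar> ^ k * \<bar>chebyshev k (\<rho> t P Q)\<bar>" for P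
      by (simp add: G(2) \<rho>_def g_def abs_mult power_abs)
    moreover have "0 < \<bar>g (x Q)\<bar> ^ k" using g by simp
    ultimately show "(\<Sum>P\<in>S - {Q}. \<bar>G P (x Q)\<bar>) < \<bar>G Q (x Q)\<bar>"
      using dom[OF Q] by (simp add: sum_distrib_left[symmetric])
  qed
qed

text \<open>
  Pigeonhole on a grid of mesh \<open>\<epsilon> / n\<close> in each of the \<open>n\<^sup>2\<close> entries: two matrices in the same cell
  are at distance at most \<open>\<epsilon>\<close>.
\<close>

lemma card_separated_matrices_le:
  fixes S :: "(real^'n^'n) set"
  assumes bound: "\<And>P i j. P \<in> S \<Longrightarrow> \<bar>P $ i $ j\<bar> \<le> 1"
    and sep: "pairwise (\<lambda>P Q. \<epsilon> < dist P Q) S"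
    and \<epsilon>: "0 < \<epsilon>" "\<epsilon> \<le> 1"
  shows "real (card S) \<le> (4 * real CARD('n) / \<epsilon>) ^ (CARD('n) * CARD('n))"
proof -
  define w where "w = real CARD('n) / \<epsilon>"
  have "\<epsilon> \<le> real CARD('n)" using zero_less_card_finite[where 'a='n] \<epsilon>(2) by linarith
  then have w: "1 \<le> w" using \<epsilon>(1) unfolding w_def by (simp add: le_divide_eq)
  define cell where "cell = (\<lambda>(P :: real^'n^'n) p. \<lfloor>P $ fst p $ snd p * w\<rfloor>)"
  have inj: "inj_on cell S"
  proof (rule inj_onI, rule ccontr)
    fix P Q assume PQ: "P \<in> S" "Q \<in> S" "cell P = cell Q" "P \<noteq> Q"
    have "\<bar>P $ i $ j - Q $ i $ j\<bar> \<le> \<epsilon> / real CARD('n)" for i j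
    proof -
      have "\<lfloor>P $ i $ j * w\<rfloor> = \<lfloor>Q $ i $ j * w\<rfloor>"
        using fun_cong[OF PQ(3), of "(i, j)"] by (simp add: cell_def)
      then have "\<bar>P $ i $ j * w - Q $ i $ j * w\<bar> \<le> 1" by linarith
      then have "\<bar>P $ i $ j - Q $ i $ j\<bar> * w \<le> 1"
        using w by (simp add: left_diff_distrib[symmetric] abs_mult)
      then show ?thesis using w \<epsilon>(1) by (simp add: w_def field_simps)
    qed
    then have entry: "(P $ i $ j - Q $ i $ j)\<^sup>2 \<le> (\<epsilon> / real CARD('n))\<^sup>2" for i j
      using power_mono[of "\<bar>P $ i $ j - Q $ i $ j\<bar>" "\<epsilon> / real CARD('n)" 2] by simp
    have "(dist P Q)\<^sup>2 = (\<Sum>i\<in>UNIV. \<Sum>j\<in>UNIV. (P $ i $ j - Q $ i $ j)\<^sup>2)"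
      unfolding dist_matrix_eq_HS by (rule real_sqrt_pow2) (simp add: sum_nonneg)
    also have "\<dots> \<le> (\<Sum>i\<in>(UNIV :: 'n set). \<Sum>j\<in>(UNIV :: 'n set). (\<epsilon> / real CARD('n))\<^sup>2)"
      by (intro sum_mono entry)
    also have "\<dots> = \<epsilon>\<^sup>2" by (simp add: power2_eq_square)
    finally have "dist P Q \<le> \<epsilon>" by (rule power2_le_imp_le) (use \<epsilon>(1) in simp)
    moreover have "\<epsilon> < dist P Q" using sep PQ by (auto simp: pairwise_def)
    ultimately show False by simp
  qed
  let ?B = "(UNIV :: ('n \<times> 'n) set) \<rightarrow>\<^sub>E {\<lfloor>- w\<rfloor>..\<lfloor>w\<rfloor>}"
  have "cell ` S \<subseteq> ?B"
  proof -
    have "- w \<le> P $ i $ j * w" "P $ i $ j * w \<le> w" if "P \<in> S" for P i j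
      using mult_right_mono[of "P $ i $ j" 1 w] mult_right_mono[of "-1" "P $ i $ j" w] bound[OF that, of i j] w
      by auto
    then show ?thesis by (auto simp: cell_def intro!: floor_mono)
  qed
  then have "card S \<le> card ?B"
    using card_image[OF inj] card_mono[of ?B "cell ` S"] by (simp add: finite_PiE)
  also have "card ?B = nat (\<lfloor>w\<rfloor> - \<lfloor>- w\<rfloor> + 1) ^ (CARD('n) * CARD('n))"
    by (simp add: card_PiE)
  finally have "real (card S) \<le> real (nat (\<lfloor>w\<rfloor> - \<lfloor>- w\<rfloor> + 1)) ^ (CARD('n) * CARD('n))"
    by (metis of_nat_le_iff of_nat_power)
  also have "\<dots> \<le> (4 * w) ^ (CARD('n) * CARD('n))"
  proof (intro power_mono)
    have "real (nat (\<lfloor>w\<rfloor> - \<lfloor>- w\<rfloor> + 1)) \<le> 2 * w + 2" using w by linarith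
    then show "real (nat (\<lfloor>w\<rfloor> - \<lfloor>- w\<rfloor> + 1)) \<le> 4 * w" using w by linarith
  qed simp
  finally show ?thesis by (simp add: w_def)
qed

text \<open>
  A separated set of maximal cardinality is a net, since a point that it misses could be added.
\<close>

lemma covering_number_le_packing_bound:
  fixes T :: "'a::metric_space set"
  assumes "0 \<le> \<epsilon>"
    and packing: "\<And>S. finite S \<Longrightarrow> S \<subseteq> T \<Longrightarrow> pairwise (\<lambda>P Q. \<epsilon> < dist P Q) S \<Longrightarrow> real (card S) \<le> B"
  shows "ereal_of_enat (covering_number \<epsilon> T) \<le> ereal B"
proof -
  define packed where "packed = (\<lambda>S. finite S \<and> S \<subseteq> T \<and> pairwise (\<lambda>P Q. \<epsilon> < dist P Q) S)"
  have "packed {}" by (simp add: packed_def pairwise_def)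
  moreover have "\<forall>S. packed S \<longrightarrow> card S < nat \<lfloor>B\<rfloor> + 1"
    using packing unfolding packed_def by (metis le_nat_floor less_Suc_eq_le Suc_eq_plus1)
  ultimately obtain S where S: "packed S" and max: "\<And>S'. packed S' \<Longrightarrow> card S' \<le> card S"
    using ex_has_greatest_nat[of packed "{}" card] by blast
  have "\<exists>Q\<in>S. dist P Q \<le> \<epsilon>" if P: "P \<in> T" for P
  proof (rule ccontr)
    assume far: "\<not> (\<exists>Q\<in>S. dist P Q \<le> \<epsilon>)"
    then have "packed (insert P S)"
      using S P by (auto simp: packed_def pairwise_insert dist_commute not_le)
    moreover have "P \<notin> S" using far assms(1) by auto
    ultimately show False using max[of "insert P S"] S by (simp add: packed_def)
  qed
  then have "eps_net \<epsilon> T S" using S by (auto simp: eps_net_def packed_def)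
  then have "covering_number \<epsilon> T \<le> enat (card S)"
    unfolding covering_number_def using S by (intro INF_lower) (auto simp: packed_def)
  then have "ereal_of_enat (covering_number \<epsilon> T) \<le> ereal_of_enat (enat (card S))"
    by (simp only: ereal_of_enat_le_iff)
  also have "\<dots> \<le> ereal B" using S packing by (auto simp: packed_def)
  finally show ?thesis .
qed

text \<open>
  The degree needed to separate \<open>Y ^ (m + 1)\<close> points contains the logarithm \<open>L = ln Y\<close>, and the
  one spare factor \<open>Y\<close> on the right pays for it: \<open>Y ^ (m + 1) = (Y * exp (L / m)) ^ m\<close> with
  \<open>exp (L / m) \<ge> 1 + L / n\<^sup>2\<close>. This is where \<open>m \<le> n * n\<close> and the constant \<open>12 \<ge> 4 * exp 1\<close> enter.
\<close>

lemma packing_exponent_arithmetic: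
  fixes \<epsilon> :: real and n q m k :: nat
  assumes \<epsilon>: "0 < \<epsilon>" "\<epsilon> \<le> 1" and q: "1 \<le> q" and n: "2 \<le> n" and m: "1 \<le> m" "m \<le> n * n"
    and Y: "Y = 12 * real q * real n ^ 3 / \<epsilon>"
    and k: "real k \<le> real n / \<epsilon> * ln (2 * Y ^ (m + 1)) + 1"
  shows "(exp 1 * (1 + real (k * (2 * q)) / real m)) ^ m \<le> Y ^ (m + 1)"
proof -
  define a where "a = real q * real n / \<epsilon>"
  define L where "L = ln Y"
  have n1: "1 \<le> real n" and q1: "1 \<le> real q" and m1: "1 \<le> real m" using n q m by auto
  have "real q * 1 \<le> real q * (real n / \<epsilon>)"
    using \<epsilon> n1 q1 by (intro mult_left_mono) auto
  then have aq: "real q \<le> a" by (simp add: a_def)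
  have Ya: "Y = 12 * a * (real n)\<^sup>2" by (simp add: Y a_def power3_eq_cube power2_eq_square)
  have n4: "4 \<le> (real n)\<^sup>2" using n power_mono[of 2 "real n" 2] by simp
  have a0: "1 \<le> a" using aq q1 by linarith
  have "1 * 4 \<le> a * (real n)\<^sup>2" using a0 n4 by (intro mult_mono) auto
  then have Y1: "48 \<le> Y" by (simp add: Ya)
  then have L0: "0 \<le> L" by (simp add: L_def)
  have "ln (2 * Y ^ (m + 1)) = ln 2 + real (m + 1) * L"
    using Y1 by (simp add: ln_mult L_def ln_realpow del: power_Suc)
  also have "\<dots> \<le> real m + 2 * real m * L"
  proof (rule add_mono)
    show "ln 2 \<le> real m" using ln_le_minus_one[of 2] m1 by simp
    show "real (m + 1) * L \<le> 2 * real m * L" using L0 m1 by (intro mult_right_mono) auto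
  qed
  finally have "real n / \<epsilon> * ln (2 * Y ^ (m + 1)) \<le> real n / \<epsilon> * (real m + 2 * real m * L)"
    using \<epsilon> by (intro mult_left_mono) auto
  then have "real k \<le> real n / \<epsilon> * (real m + 2 * real m * L) + real m"
    using k m1 by linarith
  then have "real k * (2 * real q) \<le> (real n / \<epsilon> * (real m + 2 * real m * L) + real m) * (2 * real q)"
    by (rule mult_right_mono) simp
  then have "real k * (2 * real q) / real m \<le> (real n / \<epsilon> * (1 + 2 * L) + 1) * (2 * real q)"
    using m1 by (simp add: divide_le_eq) (simp add: algebra_simps)
  also have "\<dots> = 2 * a * (1 + 2 * L) + 2 * real q"
    using \<epsilon>(1) by (simp add: a_def field_simps)
  finally have "1 + real (k * (2 * q)) / real m \<le> 5 * a + 4 * a * L"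
    using aq a0 by (simp add: algebra_simps)
  then have "exp 1 * (1 + real (k * (2 * q)) / real m) \<le> 3 * (5 * a + 4 * a * L)"
    using a0 L0 exp_le by (intro mult_mono) auto
  also have "\<dots> = 15 * a + 12 * a * L" by simp
  also have "\<dots> \<le> Y + 12 * a * L"
  proof -
    have "12 * a * 4 \<le> 12 * a * (real n)\<^sup>2" using a0 n4 by (intro mult_left_mono) auto
    then show ?thesis using a0 by (simp add: Ya)
  qed
  also have "\<dots> \<le> Y * (1 + L / real m)"
  proof -
    have "real m \<le> real n * real n" using m(2) by (metis of_nat_le_iff of_nat_mult)
    then have "12 * a * L * real m \<le> 12 * a * L * (real n)\<^sup>2"
      using a0 L0 by (intro mult_left_mono) (auto simp: power2_eq_square)
    then have "12 * a * L \<le> Y * L / real m"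
      using m1 by (simp add: Ya le_divide_eq algebra_simps)
    then show ?thesis by (simp add: algebra_simps)
  qed
  also have "\<dots> \<le> Y * exp (L / real m)"
    using Y1 by (intro mult_left_mono) (auto simp: exp_ge_add_one_self)
  finally have "(exp 1 * (1 + real (k * (2 * q)) / real m)) ^ m \<le> (Y * exp (L / real m)) ^ m"
    by (intro power_mono) auto
  also have "\<dots> = Y ^ m * exp L"
    using m1 by (simp add: power_mult_distrib exp_of_nat_mult[symmetric])
  also have "\<dots> = Y ^ (m + 1)" using Y1 by (simp add: L_def)
  finally show ?thesis .
qed

section \<open>Covering the projections of a matrix family\<close>

lemma poly_fun_XV:
  fixes X :: "'n::finite \<Rightarrow> real^'d2^'d1"
  shows "poly_fun 1 (\<lambda>v :: 'd2 \<times> 'r::finite \<Rightarrow> real. XV X (\<chi> i j. v (i, j)) $ i $ c)"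
proof -
  have "poly_fun 1 (\<lambda>v :: 'd2 \<times> 'r \<Rightarrow> real. \<Sum>l\<in>UNIV. X i $ fst c $ l * v (l, snd c))"
    by (intro poly_fun_sum poly_fun_cmult poly_fun_coord)
  then show ?thesis by (simp add: XV_def vec_mat_def matrix_matrix_mult_def)
qed

lemma PP_eq:
  fixes X :: "'n::finite \<Rightarrow> real^'d2^'d1"
  shows "PP TYPE('r::finite) X =
    range (\<lambda>v :: 'd2 \<times> 'r \<Rightarrow> real. orth_proj_matrix (span (columns (XV X (\<chi> i j. v (i, j))))))"
proof -
  have "surj (\<lambda>(v :: 'd2 \<times> 'r \<Rightarrow> real). (\<chi> i j. v (i, j)) :: real^'r^'d2)"
    by (rule surjI[where f = "\<lambda>V p. V $ fst p $ snd p"]) (simp add: vec_eq_iff)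
  then have "range ((PV X :: real^'r^'d2 \<Rightarrow> _) \<circ> (\<lambda>v :: 'd2 \<times> 'r \<Rightarrow> real. \<chi> i j. v (i, j)))
    = range (PV X :: real^'r^'d2 \<Rightarrow> _)"
    by (simp only: image_comp[symmetric])
  then show ?thesis by (simp add: PP_def PV_def comp_def)
qed

text \<open>
  If the number \<open>m\<close> of parameters satisfies \<open>m + 1 \<ge> n\<^sup>2\<close>, the bound is weaker than the one that holds for all matrices with
  entries in \<open>{-1..1}\<close>. Otherwise, a larger separated set would contain one with
  \<open>\<lfloor>Y ^ (m + 1)\<rfloor> + 1\<close> points, and the polynomial packing bound with a
  suitable Chebyshev degree \<open>k\<close> allows only \<open>Y ^ (m + 1)\<close>.
\<close>

lemma card_separated_PP_le:
  fixes X :: "'n::finite \<Rightarrow> real^'d2::finite^'d1::finite"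
  assumes \<epsilon>: "0 < \<epsilon>" "\<epsilon> < 1"
    and S: "finite S" "S \<subseteq> PP TYPE('r::finite) X" "pairwise (\<lambda>P Q. \<epsilon> < dist P Q) S"
    and Y: "Y = 12 * real (CARD('r) * CARD('d1)) * real CARD('n) ^ 3 / \<epsilon>"
  shows "real (card S) \<le> Y ^ (CARD('r) * CARD('d2) + 1)"
proof -
  define n where "n = CARD('n)"
  define q where "q = CARD('r) * CARD('d1)"
  define m where "m = CARD('r) * CARD('d2)"
  have pos: "1 \<le> n" "1 \<le> q" "1 \<le> m" by (auto simp: n_def q_def m_def Suc_le_eq)
  have Y': "Y = 12 * real q * real n ^ 3 / \<epsilon>" by (simp add: Y q_def n_def)
  have wide: "4 * real n / \<epsilon> \<le> Y"
  proof -
    have "1 \<le> real q * (real n)\<^sup>2" using pos by (simp add: mult_ge1_I)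
    then have "4 * real n * 1 \<le> 12 * real n * (real q * (real n)\<^sup>2)" by (intro mult_mono) auto
    then show ?thesis using \<epsilon>(1) by (simp add: Y' divide_right_mono power3_eq_cube power2_eq_square mult_ac)
  qed
  have "1 \<le> 4 * real n / \<epsilon>" using \<epsilon> pos by simp
  with wide have Y1: "1 \<le> Y" by linarith
  show ?thesis
  proof (cases "n * n \<le> m + 1")
    case True
    have "\<bar>P $ i $ j\<bar> \<le> 1" if "P \<in> S" for P i j
    proof -
      have "P \<in> PP TYPE('r) X" using that S(2) by blast
      then obtain T where "P = orth_proj_matrix (span T)" by (auto simp: PP_eq)
      then show ?thesis
        using abs_orth_proj_entry_le_1[OF is_orth_proj_matrix_orth_proj_matrix[OF subspace_span]] by simp
    qed
    then have "real (card S) \<le> (4 * real n / \<epsilon>) ^ (n * n)"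
      unfolding n_def using \<epsilon> by (intro card_separated_matrices_le S(3)) auto
    also have "\<dots> \<le> Y ^ (n * n)" using wide \<epsilon>(1) by (intro power_mono) auto
    also have "\<dots> \<le> Y ^ (m + 1)" using True Y1 by (intro power_increasing) auto
    finally show ?thesis by (simp add: m_def)
  next
    case False
    have n2: "2 \<le> n" using False pos by (cases "n = 1") auto
    show ?thesis
    proof (rule ccontr)
      assume "\<not> ?thesis"
      then have big: "Y ^ (m + 1) < real (card S)" by (simp add: m_def)
      define K where "K = nat \<lfloor>Y ^ (m + 1)\<rfloor> + 1"
      have K: "real K - 1 \<le> Y ^ (m + 1)" "Y ^ (m + 1) < real K"
        using one_le_power[OF Y1, of "m + 1"] unfolding K_def by linarith+
      have "K \<le> card S"
        using big one_le_power[OF Y1, of "m + 1"] unfolding K_def by linarith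
      then obtain S' where S': "S' \<subseteq> S" "card S' = K"
        using obtain_subset_with_card_n by metis
      \<comment> \<open>With \<open>z \<ge> exp (\<epsilon> / n)\<close>, this degree makes \<open>z ^ k / 2\<close> reach the bound on the cardinality.\<close>
      define k where "k = nat \<lceil>real n / \<epsilon> * ln (2 * Y ^ (m + 1))\<rceil>"
      define z where "z = (1 + \<epsilon> / real n) / (1 - \<epsilon> / real n)"
      have Ym: "1 \<le> Y ^ (m + 1)" using Y1 by (rule one_le_power)
      then have log: "0 < real n / \<epsilon> * ln (2 * Y ^ (m + 1))"
        using \<epsilon>(1) pos by (intro mult_pos_pos ln_gt_zero) auto
      have k: "real n / \<epsilon> * ln (2 * Y ^ (m + 1)) \<le> real k"
        "real k \<le> real n / \<epsilon> * ln (2 * Y ^ (m + 1)) + 1" "0 < k"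
        using log unfolding k_def by linarith+
      have "2 * Y ^ (m + 1) \<le> z ^ k"
      proof -
        have x: "0 < \<epsilon> / real n" "\<epsilon> / real n < 1" using \<epsilon> n2 by (auto simp: divide_less_eq)
        have "ln (2 * Y ^ (m + 1)) \<le> real k * (\<epsilon> / real n)"
          using k(1) \<epsilon>(1) pos by (simp add: field_simps)
        then have "exp (ln (2 * Y ^ (m + 1))) \<le> exp (\<epsilon> / real n) ^ k"
          by (simp add: exp_of_nat_mult[symmetric])
        then have "2 * Y ^ (m + 1) \<le> exp (\<epsilon> / real n) ^ k" using Ym by (simp del: power_Suc)
        also have "\<dots> \<le> z ^ k"
        proof (intro power_mono)
          have "1 - \<epsilon> / real n \<le> exp (- (\<epsilon> / real n))"
            using exp_ge_add_one_self[of "- (\<epsilon> / real n)"] by simp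
          then have "exp (\<epsilon> / real n) * (1 - \<epsilon> / real n) \<le> 1"
            by (simp add: exp_minus field_simps)
          then show "exp (\<epsilon> / real n) \<le> z" using x by (simp add: z_def le_divide_eq)
        qed simp
        finally show ?thesis .
      qed
      then have "card S' \<le> card (exponents (k * (2 * CARD('d1 \<times> 'r))) :: ('d2 \<times> 'r \<Rightarrow> nat) set)"
        using S S' \<epsilon> n2 K(1)
        by (intro card_separated_orth_proj_le[OF poly_fun_XV[of X]])
          (auto simp: PP_eq z_def n_def intro: finite_subset pairwise_subset)
      then have "real K \<le> real (card (exponents (k * (2 * q)) :: ('d2 \<times> 'r \<Rightarrow> nat) set))"
        using S'(2) by (simp add: q_def mult.commute)
      also have "\<dots> \<le> (exp 1 * (1 + real (k * (2 * q)) / real CARD('d2 \<times> 'r))) ^ CARD('d2 \<times> 'r)"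
        using k(3) pos by (intro card_exponents_le) auto
      also have "CARD('d2 \<times> 'r) = m" by (simp add: m_def mult.commute)
      also have "(exp 1 * (1 + real (k * (2 * q)) / real m)) ^ m \<le> Y ^ (m + 1)"
        using \<epsilon> pos n2 False k(2) by (intro packing_exponent_arithmetic[where n = n and \<epsilon> = \<epsilon>] Y') auto
      finally show False using K(2) by simp
    qed
  qed
qed

theorem theorem1:
  fixes X :: "'n::finite \<Rightarrow> real^'d2::finite^'d1::finite" and \<epsilon> :: real
  assumes "CARD('d1) \<le> CARD('d2)"
    and "0 < \<epsilon>" and "\<epsilon> < 1"
  shows "ereal_of_enat (covering_number \<epsilon> (PP TYPE('r::finite) X)) \<le>
    ereal (2 ^ (CARD('r) * CARD('d1)) *
      (12 * real CARD('r) * real CARD('d1) * real CARD('n) ^ 3 / \<epsilon>) ^ (CARD('r) * CARD('d2) + 1))"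
proof (rule covering_number_le_packing_bound)
  fix S assume S: "finite S" "S \<subseteq> PP TYPE('r) X" "pairwise (\<lambda>P Q. \<epsilon> < dist P Q) S"
  let ?B = "(12 * real CARD('r) * real CARD('d1) * real CARD('n) ^ 3 / \<epsilon>) ^ (CARD('r) * CARD('d2) + 1)"
  have "real (card S) \<le> ?B"
    by (rule card_separated_PP_le[OF assms(2,3) S]) simp
  also have "1 * ?B \<le> 2 ^ (CARD('r) * CARD('d1)) * ?B"
    using assms(2) by (intro mult_right_mono) auto
  finally show "real (card S) \<le> 2 ^ (CARD('r) * CARD('d1)) * ?B" by simp
qed (use assms in simp)

end
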